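(* Suppose that at least one of the following holds: (a) the sequence $\delta\{q_{2k}\}-\{p_{2k}\}$ $(k=1,2,3,\dots)$ has a monotonically non-decreasing (infinite) subsequence; (b) the sequence $\delta\{q_{2k-1}\}-\{p_{2k-1}\}$ $(k=1,2,3,\dots)$ has a monotonically non-increasing (infinite) subsequence. Then the Euler-Gompertz constant $\delta$ is irrational.
   Context: $\delta=\int_0^\infty\frac{e^{-t}}{t+1}\,dt$ is the Euler-Gompertz constant. $\{y\}$ denotes the fractional part of a real number $y$. The rational numbers $p_m,q_m$ are defined by $p_{-1}=1$, $q_{-1}=0$, $p_0=0$, $q_0=1$, and, for $m\ge1$, $p_m=c_mp_{m-1}+p_{m-2}$, $q_m=c_mq_{m-1}+q_{m-2}$, where $c_m=1$ if $m$ is odd and $c_m=\frac{2}{m}$ if $m$ is even. *)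

theory Defs
  imports "HOL-Analysis.Analysis"
begin

definition euler_gompertz :: real where
  "euler_gompertz = (LBINT t:{0..}. exp (- t) / (t + 1))"

definition gompertz_c :: "nat \<Rightarrow> rat" where
  "gompertz_c m = (if odd m then 1 else 2 / of_nat m)"

(* The sequences p_m, q_m start at m = -1; the auxiliary functions below are shifted by one,
   so that gompertz_p_aux (m + 1) = p_m, gompertz_q_aux (m + 1) = q_m. *)

fun gompertz_p_aux :: "nat \<Rightarrow> rat" where
  "gompertz_p_aux 0 = 1"
| "gompertz_p_aux (Suc 0) = 0"
| "gompertz_p_aux (Suc (Suc n)) =
     gompertz_c (Suc n) * gompertz_p_aux (Suc n) + gompertz_p_aux n"

fun gompertz_q_aux :: "nat \<Rightarrow> rat" where
  "gompertz_q_aux 0 = 0"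
| "gompertz_q_aux (Suc 0) = 1"
| "gompertz_q_aux (Suc (Suc n)) =
     gompertz_c (Suc n) * gompertz_q_aux (Suc n) + gompertz_q_aux n"

definition gompertz_p :: "nat \<Rightarrow> rat" where
  "gompertz_p m = gompertz_p_aux (Suc m)"

definition gompertz_q :: "nat \<Rightarrow> rat" where
  "gompertz_q m = gompertz_q_aux (Suc m)"

definition frac_error :: "nat \<Rightarrow> real" where
  "frac_error m =
     euler_gompertz * frac (of_rat (gompertz_q m)) - frac (of_rat (gompertz_p m))"

end

theory Submission
  imports Defs
begin

text \<open>
  The errors \<open>r\<^sub>m = \<delta> q\<^sub>m - p\<^sub>m\<close> have the closed forms
  \<open>r\<^sub>m = \<integral> e^(-t) t^n / (1 + t)^(n+1) dt\<close> for \<open>m = 2n\<close> and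
  \<open>r\<^sub>m = - \<integral> e^(-t) t^n / (1 + t)^n dt\<close> for \<open>m = 2n - 1\<close>, by the recurrence and one
  integration by parts. Hence the errors of even index are positive and strictly decreasing,
  those of odd index negative and strictly increasing. If \<open>\<delta>\<close> were rational with denominator
  \<open>b\<close>, then \<open>r\<^sub>m - (\<delta> {q\<^sub>m} - {p\<^sub>m}) = \<delta> \<lfloor>q\<^sub>m\<rfloor> - \<lfloor>p\<^sub>m\<rfloor>\<close> would be a bounded sequence in
  \<open>(1/b) \<int>\<close>, yet strictly monotone along the given subsequence, which is impossible.
\<close>

text \<open>The two exponents are independent because the induction passes through the pairs
  \<open>(n, n + 1)\<close>, \<open>(n + 1, n + 1)\<close> and \<open>(n, n + 2)\<close>.\<close>

definition gompertz_integral :: "nat \<Rightarrow> nat \<Rightarrow> real" where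
  "gompertz_integral a b = (LBINT t:{0..}. exp (- t) * (t ^ a / (1 + t) ^ b))"

definition gompertz_error :: "nat \<Rightarrow> real" where
  "gompertz_error m = euler_gompertz * of_rat (gompertz_q m) - of_rat (gompertz_p m)"

section \<open>Integrability, positivity and a contiguity relation\<close>

lemma set_integrable_exp_minus: "set_integrable lborel {0..} (\<lambda>t::real. exp (- t))"
proof -
  have "(\<lambda>t::real. exp (- t)) integrable_on {0..}"
    using integrable_on_exp_minus_to_infinity[of 1 0] by simp
  \<comment> \<open>Nonnegativity turns gauge integrability into absolute integrability;
    measurability of the integrand then allows the return from the completed measure to
    \<open>lborel\<close>.\<close>
  then have "set_integrable lebesgue {0..} (\<lambda>t::real. exp (- t))"
    by (intro nonnegative_absolutely_integrable_1) auto
  then show ?thesis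
    unfolding set_integrable_def by (subst (asm) integrable_completion) auto
qed

lemma norm_exp_power_quotient_le:
  fixes t :: real
  assumes "0 \<le> t" "a \<le> b"
  shows "norm (exp (- t) * (t ^ a / (1 + t) ^ b)) \<le> exp (- t)"
proof -
  have "t ^ a \<le> (1 + t) ^ a" using assms by (intro power_mono) auto
  also have "\<dots> \<le> (1 + t) ^ b" using assms by (intro power_increasing) auto
  finally have "t ^ a / (1 + t) ^ b \<le> 1" using assms by (simp add: divide_le_eq)
  then have "exp (- t) * (t ^ a / (1 + t) ^ b) \<le> exp (- t)" by (intro mult_left_le) simp_all
  then show ?thesis using assms by simp
qed

lemma gompertz_integrable:
  assumes "a \<le> b"
  shows "set_integrable lborel {0..} (\<lambda>t::real. exp (- t) * (t ^ a / (1 + t) ^ b))"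
proof (rule set_integrable_bound[OF set_integrable_exp_minus])
  show "set_borel_measurable lborel {0..} (\<lambda>t::real. exp (- t) * (t ^ a / (1 + t) ^ b))"
    unfolding set_borel_measurable_def by measurable
  show "AE t in lborel. t \<in> {0..} \<longrightarrow>
      norm (exp (- t) * (t ^ a / (1 + t) ^ b)) \<le> norm (exp (- t :: real))"
    using norm_exp_power_quotient_le[OF _ assms] by (intro AE_I2) simp
qed

lemma gompertz_integral_pos:
  assumes "a \<le> b"
  shows "0 < gompertz_integral a b"
proof -
  define f where "f t = indicator {0..} t * (exp (- t) * (t ^ a / (1 + t) ^ b))" for t :: real
  have int: "integrable lborel f"
    using gompertz_integrable[OF assms] unfolding set_integrable_def f_def by simp
  have nonneg: "0 \<le> f t" for t
    by (auto simp: f_def indicator_def)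
  have eq: "gompertz_integral a b = integral\<^sup>L lborel f"
    unfolding gompertz_integral_def set_lebesgue_integral_def f_def by simp
  have "integral\<^sup>L lborel f \<noteq> 0"
  proof
    assume "integral\<^sup>L lborel f = 0"
    then have "AE t in lborel. f t = 0"
      using integral_nonneg_eq_0_iff_AE[OF int] nonneg by simp
    \<comment> \<open>On [1, 2], away from the possible zero at t = 0, the integrand is strictly
      positive, so an interval of length 1 would be a null set.\<close>
    then have "AE t in lborel. t \<notin> {1..2::real}"
      by (rule AE_mp) (auto simp: f_def indicator_def)
    then have "emeasure lborel {1..2::real} = 0"
      by (subst (asm) AE_iff_measurable[of "{1..2}"]) auto
    then show False by simp
  qed
  moreover have "0 \<le> integral\<^sup>L lborel f" using nonneg by simp
  ultimately show ?thesis using eq by simp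
qed

lemma gompertz_integral_0_1: "gompertz_integral 0 1 = euler_gompertz"
  by (simp add: gompertz_integral_def euler_gompertz_def add.commute)

text \<open>Integrates 1 - t/(1 + t) = 1/(1 + t) against the weight exp(-t) t^a / (1 + t)^b.\<close>

lemma gompertz_integral_diff:
  assumes "a \<le> b"
  shows "gompertz_integral a b - gompertz_integral (Suc a) (Suc b) = gompertz_integral a (Suc b)"
proof -
  have "gompertz_integral a b - gompertz_integral (Suc a) (Suc b) =
    (LBINT t:{0..}. exp (- t) * (t ^ a / (1 + t) ^ b) - exp (- t) * (t ^ Suc a / (1 + t) ^ Suc b))"
    unfolding gompertz_integral_def
    using assms by (intro set_integral_diff(2)[symmetric] gompertz_integrable) auto
  also have "\<dots> = gompertz_integral a (Suc b)"
    unfolding gompertz_integral_def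
  proof (rule set_lebesgue_integral_cong, simp, intro allI impI)
    fix t :: real assume "t \<in> {0..}"
    then have "t ^ a / (1 + t) ^ b = t ^ a * (1 + t) / (1 + t) ^ Suc b"
      by simp
    then have "t ^ a / (1 + t) ^ b - t ^ Suc a / (1 + t) ^ Suc b = t ^ a / (1 + t) ^ Suc b"
      by (simp add: algebra_simps flip: diff_divide_distrib)
    then show "exp (- t) * (t ^ a / (1 + t) ^ b) - exp (- t) * (t ^ Suc a / (1 + t) ^ Suc b) =
        exp (- t) * (t ^ a / (1 + t) ^ Suc b)"
      by (metis right_diff_distrib)
  qed
  finally show ?thesis .
qed

section \<open>Integration by parts on the half-line\<close>

lemma set_integral_FTC_atLeast:
  fixes f F :: "real \<Rightarrow> real"
  assumes F: "\<And>x. a \<le> x \<Longrightarrow> (F has_real_derivative f x) (at x)"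
    and cont: "continuous_on {a..} f"
    and int: "set_integrable lborel {a..} f"
    and lim: "(F \<longlongrightarrow> L) at_top"
  shows "(LBINT x:{a..}. f x) = L - F a"
proof (rule tendsto_unique[OF trivial_limit_at_top_linorder])
  \<comment> \<open>Both sides are limits of the integral over [a, b] as b tends to infinity, so
    uniqueness of limits identifies them.\<close>
  show "((\<lambda>b. LBINT x:{a..b}. f x) \<longlongrightarrow> (LBINT x:{a..}. f x)) at_top"
    by (rule tendsto_set_lebesgue_integral_at_top[OF _ int]) auto
  have "(LBINT x:{a..b}. f x) = F b - F a" if "a \<le> b" for b
    unfolding set_lebesgue_integral_def using that
    by (intro integral_FTC_atLeastAtMost continuous_on_subset[OF cont])
      (auto intro!: has_vector_derivative_at_within
        F[THEN has_real_derivative_iff_has_vector_derivative[THEN iffD1]])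
  then have "\<forall>\<^sub>F b in at_top. F b - F a = (LBINT x:{a..b}. f x)"
    by (intro eventually_at_top_linorderI[of a]) simp
  then show "((\<lambda>b. LBINT x:{a..b}. f x) \<longlongrightarrow> L - F a) at_top"
    by (rule Lim_transform_eventually[rotated]) (intro tendsto_intros lim)
qed

lemma exp_minus_power_quotient_tendsto_0:
  "((\<lambda>t::real. exp (- t) * (t ^ n / (1 + t) ^ n)) \<longlongrightarrow> 0) at_top"
proof (rule Lim_null_comparison)
  show "((\<lambda>t::real. exp (- t)) \<longlongrightarrow> 0) at_top"
    by (rule filterlim_compose[OF exp_at_bot filterlim_uminus_at_bot_at_top])
  show "\<forall>\<^sub>F t::real in at_top. norm (exp (- t) * (t ^ n / (1 + t) ^ n)) \<le> exp (- t)"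
    by (intro eventually_at_top_linorderI[of 0] norm_exp_power_quotient_le) auto
qed

lemma gompertz_integral_0_0: "gompertz_integral 0 0 = 1"
proof -
  have "(LBINT t:{0..}. exp (- t)) = 0 - (- exp (- (0::real)))"
  proof (rule set_integral_FTC_atLeast[OF _ _ set_integrable_exp_minus])
    show "((\<lambda>t::real. - exp (- t)) \<longlongrightarrow> 0) at_top"
      using tendsto_minus[OF exp_minus_power_quotient_tendsto_0[of 0]] by simp
  qed (auto intro!: derivative_eq_intros continuous_intros)
  then show ?thesis by (simp add: gompertz_integral_def)
qed

text \<open>Integrate the derivative of exp(-t) (t/(1 + t))^(n+1), using that t/(1 + t) has
  derivative 1/(1 + t)^2. The boundary terms vanish: at 0 because the exponent is positive, at
  infinity because of exp(-t).\<close>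

lemma gompertz_integral_by_parts:
  "real (Suc n) * gompertz_integral n (n + 2) = gompertz_integral (Suc n) (Suc n)"
proof -
  let ?g = "\<lambda>a b t::real. exp (- t) * (t ^ a / (1 + t) ^ b)"
  let ?f = "\<lambda>t. real (Suc n) * ?g n (n + 2) t - ?g (Suc n) (Suc n) t"
  have int: "set_integrable lborel {0..} (\<lambda>t. real (Suc n) * ?g n (n + 2) t)"
    by (intro set_integrable_mult_right impI gompertz_integrable) auto
  have int': "set_integrable lborel {0..} (?g (Suc n) (Suc n))"
    by (intro gompertz_integrable) auto
  have deriv: "(?g (Suc n) (Suc n) has_real_derivative ?f t) (at t)" if "0 \<le> t" for t
  proof -
    have u: "((\<lambda>t. t / (1 + t)) has_real_derivative 1 / (1 + t)\<^sup>2) (at t)"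
      using that by (auto intro!: derivative_eq_intros simp: power2_eq_square divide_simps)
    have "((\<lambda>t. exp (- t) * (t / (1 + t)) ^ Suc n) has_real_derivative
        exp (- t) * (real (Suc n) * (1 / (1 + t)\<^sup>2) * (t / (1 + t)) ^ n)
          - exp (- t) * (t / (1 + t)) ^ Suc n) (at t)"
      by (rule derivative_eq_intros u refl)+ (simp add: algebra_simps)
    then show ?thesis
      by (simp add: power_divide power_add mult_ac power2_eq_square)
  qed
  have cont: "continuous_on {0..} ?f"
    by (auto intro!: continuous_intros)
  have "(LBINT t:{0..}. ?f t) = 0 - ?g (Suc n) (Suc n) 0"
    by (rule set_integral_FTC_atLeast[OF deriv cont set_integral_diff(1)[OF int int']
          exp_minus_power_quotient_tendsto_0])
  moreover have "(LBINT t:{0..}. ?f t) =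
      real (Suc n) * gompertz_integral n (n + 2) - gompertz_integral (Suc n) (Suc n)"
    unfolding gompertz_integral_def
    by (subst set_integral_diff(2)[OF int int']) (simp only: set_integral_mult_right)
  ultimately show ?thesis by simp
qed

section \<open>Closed forms, signs and monotonicity of the errors\<close>

lemma gompertz_error_0: "gompertz_error 0 = euler_gompertz"
  by (simp add: gompertz_error_def gompertz_p_def gompertz_q_def)

lemma gompertz_error_1: "gompertz_error (Suc 0) = euler_gompertz - 1"
  by (simp add: gompertz_error_def gompertz_p_def gompertz_q_def gompertz_c_def)

lemma gompertz_error_rec:
  "gompertz_error (Suc (Suc m)) =
    of_rat (gompertz_c (Suc (Suc m))) * gompertz_error (Suc m) + gompertz_error m"
  by (simp add: gompertz_error_def gompertz_p_def gompertz_q_def of_rat_add of_rat_mult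
      algebra_simps)

lemma gompertz_error_eq_integral:
  "gompertz_error (2 * n) = gompertz_integral n (Suc n) \<and>
   gompertz_error (2 * n + 1) = - gompertz_integral (Suc n) (Suc n)"
proof (induction n)
  case 0
  then show ?case
    using gompertz_integral_diff[of 0 0] gompertz_integral_0_1
    by (simp add: gompertz_error_0 gompertz_error_1 gompertz_integral_0_0)
next
  case (Suc n)
  have c: "of_rat (gompertz_c (2 * n + 2)) = 1 / real (Suc n)"
    by (simp add: gompertz_c_def of_rat_divide of_rat_add of_rat_mult divide_simps)
  have even: "gompertz_error (2 * Suc n) = gompertz_integral (Suc n) (Suc (Suc n))"
  proof -
    have "gompertz_error (2 * Suc n) =
        - (gompertz_integral (Suc n) (Suc n) / real (Suc n)) + gompertz_integral n (Suc n)"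
      using gompertz_error_rec[of "2 * n"] c Suc.IH by simp
    \<comment> \<open>The recurrence coefficient 2/(2n + 2) = 1/(n + 1) cancels exactly the factor
      produced by integration by parts.\<close>
    also have "gompertz_integral (Suc n) (Suc n) / real (Suc n) = gompertz_integral n (n + 2)"
      by (simp flip: gompertz_integral_by_parts)
    finally show ?thesis
      using gompertz_integral_diff[of n "Suc n"] by simp
  qed
  have "gompertz_error (2 * Suc n + 1) = gompertz_error (2 * Suc n) + gompertz_error (2 * n + 1)"
    using gompertz_error_rec[of "2 * n + 1"] by (simp add: gompertz_c_def)
  then show ?case
    using even Suc.IH gompertz_integral_diff[of "Suc n" "Suc n"] by simp
qed

lemma gompertz_error_even_pos: "0 < gompertz_error (2 * n)"
  using gompertz_error_eq_integral[of n] gompertz_integral_pos[of n "Suc n"] by simp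

lemma gompertz_error_odd_neg: "gompertz_error (2 * n + 1) < 0"
  using gompertz_error_eq_integral[of n] gompertz_integral_pos[of "Suc n" "Suc n"] by simp

text \<open>By the recurrence, consecutive errors of even index differ by a positive coefficient
  times the negative odd-index error between them. Negating makes the sequence increase, as
  \<open>no_bounded_strict_mono_multiples\<close> expects.\<close>

lemma strict_mono_minus_gompertz_error_even: "strict_mono (\<lambda>n. - gompertz_error (2 * n))"
proof (rule strict_monoI_Suc)
  fix n
  have "of_rat (gompertz_c (2 * n + 2)) * gompertz_error (2 * n + 1) < 0"
    using gompertz_error_odd_neg[of n] by (intro mult_pos_neg) (simp_all add: gompertz_c_def)
  then show "- gompertz_error (2 * n) < - gompertz_error (2 * Suc n)"
    using gompertz_error_rec[of "2 * n"] by simp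
qed

text \<open>Here the coefficient is 1, so each increment is the positive even-index error in
  between.\<close>

lemma strict_mono_gompertz_error_odd: "strict_mono (\<lambda>n. gompertz_error (2 * n + 1))"
proof (rule strict_monoI_Suc)
  fix n
  show "gompertz_error (2 * n + 1) < gompertz_error (2 * Suc n + 1)"
    using gompertz_error_rec[of "2 * n + 1"] gompertz_error_even_pos[of "Suc n"]
    by (simp add: gompertz_c_def)
qed

section \<open>Fractional parts and discreteness\<close>

lemma abs_frac_error_le: "\<bar>frac_error m\<bar> \<le> \<bar>euler_gompertz\<bar> + 1"
proof -
  let ?q = "frac (of_rat (gompertz_q m)) :: real" and ?p = "frac (of_rat (gompertz_p m)) :: real"
  have "\<bar>euler_gompertz * ?q\<bar> \<le> \<bar>euler_gompertz\<bar>"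
    using frac_ge_0 frac_lt_1[of "of_rat (gompertz_q m) :: real"]
    by (simp add: abs_mult mult_left_le less_imp_le)
  moreover have "\<bar>?p\<bar> \<le> 1"
    using frac_ge_0 frac_lt_1[of "of_rat (gompertz_p m) :: real"] by (simp add: less_imp_le)
  ultimately show ?thesis unfolding frac_error_def by linarith
qed

text \<open>Although \<open>gompertz_p\<close> and \<open>gompertz_q\<close> are only rational, this
  difference is a linear form in \<delta> with integer coefficients, hence a multiple of 1/b when
  \<delta> = a/b.\<close>

lemma gompertz_error_minus_frac_error:
  "gompertz_error m - frac_error m =
    euler_gompertz * of_int \<lfloor>of_rat (gompertz_q m) :: real\<rfloor> - of_int \<lfloor>of_rat (gompertz_p m) :: real\<rfloor>"
  by (simp add: gompertz_error_def frac_error_def frac_def algebra_simps)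

lemma strict_mono_int_unbounded:
  fixes h :: "nat \<Rightarrow> int"
  assumes "strict_mono h"
  shows "\<exists>j. B < h j"
proof -
  have "h 0 + int j \<le> h j" for j
  proof (induction j)
    case (Suc j)
    then show ?case using strict_monoD[OF assms, of j "Suc j"] by simp
  qed simp
  from this[of "nat (B - h 0 + 1)"] have "B < h (nat (B - h 0 + 1))" by linarith
  then show ?thesis ..
qed

text \<open>After scaling by \<open>b\<close> the values are integers, so every step of the sequence
  gains at least 1/b and any bound is eventually passed.\<close>

lemma no_bounded_strict_mono_multiples:
  fixes g :: "nat \<Rightarrow> real"
  assumes "strict_mono g" "\<And>j. g j \<le> B" "0 < b" "\<And>j. b * g j \<in> \<int>"
  shows False
proof -
  obtain h where h: "\<And>j. b * g j = of_int (h j)"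
    using assms(4) unfolding Ints_def image_iff by metis
  have "strict_mono h"
  proof (rule strict_monoI)
    fix i j :: nat assume "i < j"
    then have "b * g i < b * g j" using assms by (simp add: strict_mono_less)
    then show "h i < h j" by (simp add: h)
  qed
  then obtain j where "\<lceil>b * B\<rceil> < h j" using strict_mono_int_unbounded by blast
  then have "b * B < b * g j" unfolding h by linarith
  then show False using assms(2)[of j] \<open>0 < b\<close> by simp
qed

theorem theorem7p4:
  assumes "(\<exists>r :: nat \<Rightarrow> nat. strict_mono r \<and> (\<forall>j. 1 \<le> r j) \<and>
              incseq (\<lambda>j. frac_error (2 * r j)))
         \<or> (\<exists>r :: nat \<Rightarrow> nat. strict_mono r \<and> (\<forall>j. 1 \<le> r j) \<and>
              decseq (\<lambda>j. frac_error (2 * r j - 1)))"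
  shows "euler_gompertz \<notin> \<rat>"
proof
  assume "euler_gompertz \<in> \<rat>"
  then obtain a b :: int where b: "0 < b" and ab: "euler_gompertz = of_int a / of_int b"
    by (auto elim: Rats_cases')
  define d where "d m = gompertz_error m - frac_error m" for m
  have "of_int b * d m = of_int (a * \<lfloor>of_rat (gompertz_q m) :: real\<rfloor> - b * \<lfloor>of_rat (gompertz_p m) :: real\<rfloor>)"
    for m
    unfolding d_def gompertz_error_minus_frac_error using b ab by (simp add: field_simps)
  then have d_Ints: "of_int b * d m \<in> \<int>" for m
    by (metis Ints_of_int)
  have bpos: "0 < real_of_int b" using b by simp
  note frac_bound = abs_frac_error_le[unfolded abs_le_iff]
  from assms show False
  proof (elim disjE exE conjE)
    fix r :: "nat \<Rightarrow> nat"
    assume r: "strict_mono r" and inc: "incseq (\<lambda>j. frac_error (2 * r j))"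
    show False
    proof (rule no_bounded_strict_mono_multiples[OF _ _ bpos])
      \<comment> \<open>This is a strictly increasing negated error plus a non-decreasing
        \<open>frac_error\<close>.\<close>
      show "strict_mono (\<lambda>j. - d (2 * r j))"
      proof (rule strict_monoI)
        fix i j :: nat assume "i < j"
        with r have "r i < r j" by (simp add: strict_mono_less)
        then have "- gompertz_error (2 * r i) < - gompertz_error (2 * r j)"
          by (rule strict_monoD[OF strict_mono_minus_gompertz_error_even])
        moreover have "frac_error (2 * r i) \<le> frac_error (2 * r j)"
          using incseqD[OF inc, of i j] \<open>i < j\<close> by simp
        ultimately show "- d (2 * r i) < - d (2 * r j)" by (simp add: d_def)
      qed
      \<comment> \<open>The positive error is subtracted, so the bound on \<open>frac_error\<close>
        suffices.\<close>
      show "- d (2 * r j) \<le> \<bar>euler_gompertz\<bar> + 1" for j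
        using frac_bound[of "2 * r j"] gompertz_error_even_pos[of "r j"] by (simp add: d_def)
      show "of_int b * - d (2 * r j) \<in> \<int>" for j
        using d_Ints[of "2 * r j"] by simp
    qed
  next
    fix r :: "nat \<Rightarrow> nat"
    assume r: "strict_mono r" and r1: "\<forall>j. 1 \<le> r j"
      and dec: "decseq (\<lambda>j. frac_error (2 * r j - 1))"
    \<comment> \<open>Subtraction on naturals truncates; \<open>r1\<close> ensures that the index is
      truly odd and of the form used for the odd errors.\<close>
    have idx: "2 * r j - 1 = 2 * (r j - 1) + 1" for j
      using r1[rule_format, of j] by (cases "r j") simp_all
    show False
    proof (rule no_bounded_strict_mono_multiples[OF _ _ bpos])
      show "strict_mono (\<lambda>j. d (2 * r j - 1))"
      proof (rule strict_monoI)
        fix i j :: nat assume "i < j"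
        with r have "r i < r j" by (simp add: strict_mono_less)
        with r1 have "r i - 1 < r j - 1" by (metis diff_less_mono)
        then have "gompertz_error (2 * r i - 1) < gompertz_error (2 * r j - 1)"
          unfolding idx by (rule strict_monoD[OF strict_mono_gompertz_error_odd])
        moreover have "frac_error (2 * r j - 1) \<le> frac_error (2 * r i - 1)"
          using decseqD[OF dec, of i j] \<open>i < j\<close> by simp
        ultimately show "d (2 * r i - 1) < d (2 * r j - 1)" by (simp add: d_def)
      qed
      show "d (2 * r j - 1) \<le> \<bar>euler_gompertz\<bar> + 1" for j
        using frac_bound[of "2 * r j - 1"] gompertz_error_odd_neg[of "r j - 1"]
        unfolding idx d_def by linarith
      show "of_int b * d (2 * r j - 1) \<in> \<int>" for j
        by (rule d_Ints)
    qed
  qed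
qed

end
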